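(* Consider a series network with nodes $\mathcal V=\{v_1,\dots,v_{n+1}\}$ and links $\mathcal E=\{(v_1,v_2),\dots,(v_n,v_{n+1})\}$, with lower and upper bounds on link weights $w^l,w^u\in\mathbb R^n_{>0}$, $w^l\le w^u$. If the link capacity functions $c_i:[w_i^l,w_i^u]\to\mathbb R_{>0}$ are $\mathcal S_1$ for all $i\in\{1,\dots,n\}$, then the equivalent capacity function between $v_1$ and $v_{n+1}$, $$\mathcal C(w_{\mathrm{eq}})=\max\Big\{z\in\mathbb R:\ \exists\, w\in\mathbb R^n_{>0},\ w_i^l\le w_i\le w_i^u,\ z\le c_i(w_i)\ \ \forall i\in\{1,\dots,n\},\ \Big(\sum_{i=1}^n\frac1{w_i}\Big)^{-1}=w_{\mathrm{eq}}\Big\},$$ is also an $\mathcal S_1$ function of $w_{\mathrm{eq}}\in\Big[\big(\sum_{i=1}^n 1/w_i^l\big)^{-1},\big(\sum_{i=1}^n1/w_i^u\big)^{-1}\Big]$.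
   Context: $\mathcal S_0$ function: $\psi:[x^l,x^u]\to\mathbb R$ is $\mathcal S_0$ if it is continuous and there exist $\underline x\in[x^l,x^u]$ and $\bar x\in[\underline x,x^u]$ such that $\psi$ is strictly increasing on $[x^l,\underline x]$, constant on $[\underline x,\bar x]$, and strictly decreasing on $[\bar x,x^u]$. $\mathcal S_1$ function: $\psi:[x^l,x^u]\subset\mathbb R_{>0}\to\mathbb R$ is $\mathcal S_1$ if it is $\mathcal S_0$ and there exists $x^o\in[x^l,\underline x]$ such that $\min\partial\psi(x)>\psi(x)/x$ for all $x\in[x^l,x^o)$ and $\min\partial\psi(x)=\psi(x)/x$ for all $x\in[x^o,\underline x)$. Here $\underline x$ is the first transition point of $\psi$ as an $\mathcal S_0$ function, and $\min\partial\psi(x)$ is the minimum of the left and right derivatives of $\psi$ at $x$, assumed to exist there (only the right derivative at $x=x^l$). *)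

theory Defs
  imports "HOL-Analysis.Analysis"
begin

text \<open>
  A function on \<open>[xl, xu]\<close> is a total function of which only the values on \<open>{xl..xu}\<close> matter.
  The transition points \<open>a\<close> and \<open>b\<close> are unique: \<open>{a..b}\<close> is the set of maximisers.
\<close>

definition S0_transition :: "real \<Rightarrow> real \<Rightarrow> (real \<Rightarrow> real) \<Rightarrow> real \<Rightarrow> real \<Rightarrow> bool" where
  "S0_transition xl xu \<psi> a b \<longleftrightarrow>
     a \<in> {xl..xu} \<and> b \<in> {a..xu} \<and>
     strict_mono_on {xl..a} \<psi> \<and> \<psi> constant_on {a..b} \<and> strict_antimono_on {b..xu} \<psi>"

definition S0 :: "real \<Rightarrow> real \<Rightarrow> (real \<Rightarrow> real) \<Rightarrow> bool" where
  "S0 xl xu \<psi> \<longleftrightarrow> continuous_on {xl..xu} \<psi> \<and> (\<exists>a b. S0_transition xl xu \<psi> a b)"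

text \<open>
  \<open>is_min_deriv xl \<psi> x d\<close>: the (finite) one-sided derivatives of \<open>\<psi>\<close> at \<open>x\<close> exist and their minimum
  is \<open>d\<close>; at the left end \<open>xl\<close> of the domain only the right derivative is considered.
\<close>

definition is_min_deriv :: "real \<Rightarrow> (real \<Rightarrow> real) \<Rightarrow> real \<Rightarrow> real \<Rightarrow> bool" where
  "is_min_deriv xl \<psi> x d \<longleftrightarrow>
     (if x = xl then (\<psi> has_real_derivative d) (at_right x)
      else \<exists>dl dr. (\<psi> has_real_derivative dl) (at_left x) \<and>
                   (\<psi> has_real_derivative dr) (at_right x) \<and> d = min dl dr)"

definition S1 :: "real \<Rightarrow> real \<Rightarrow> (real \<Rightarrow> real) \<Rightarrow> bool" where
  "S1 xl xu \<psi> \<longleftrightarrow>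
     0 < xl \<and> S0 xl xu \<psi> \<and>
     (\<exists>a b xo. S0_transition xl xu \<psi> a b \<and> xo \<in> {xl..a} \<and>
        (\<forall>x\<in>{xl..<xo}. \<exists>d. is_min_deriv xl \<psi> x d \<and> d > \<psi> x / x) \<and>
        (\<forall>x\<in>{xo..<a}. \<exists>d. is_min_deriv xl \<psi> x d \<and> d = \<psi> x / x))"

text \<open>
  The series network with nodes \<open>v\<^sub>1, \<dots>, v\<^sub>n\<^sub>+\<^sub>1\<close> has the links \<open>(v\<^sub>i, v\<^sub>i\<^sub>+\<^sub>1)\<close> for \<open>i \<in> {1..n}\<close>;
  link data are families indexed by \<open>i\<close>, relevant only on \<open>{1..n}\<close>.
\<close>

definition series_weight :: "nat \<Rightarrow> (nat \<Rightarrow> real) \<Rightarrow> real" where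
  "series_weight n w = inverse (\<Sum>i=1..n. 1 / w i)"

definition feasible_values ::
  "nat \<Rightarrow> (nat \<Rightarrow> real) \<Rightarrow> (nat \<Rightarrow> real) \<Rightarrow> (nat \<Rightarrow> real \<Rightarrow> real) \<Rightarrow> real \<Rightarrow> real set" where
  "feasible_values n wl wu c weq =
     {z. \<exists>w. (\<forall>i\<in>{1..n}. 0 < w i \<and> wl i \<le> w i \<and> w i \<le> wu i \<and> z \<le> c i (w i)) \<and>
             series_weight n w = weq}"

definition equiv_capacity ::
  "nat \<Rightarrow> (nat \<Rightarrow> real) \<Rightarrow> (nat \<Rightarrow> real) \<Rightarrow> (nat \<Rightarrow> real \<Rightarrow> real) \<Rightarrow> real \<Rightarrow> real" where
  "equiv_capacity n wl wu c weq = (GREATEST z. z \<in> feasible_values n wl wu c weq)"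

end

theory Submission imports Defs begin

text \<open>
  Link \<open>i\<close> can carry at least \<open>z\<close> exactly when its weight lies in an interval
  \<open>{\<alpha>\<^sub>i(z)..\<beta>\<^sub>i(z)}\<close>: here \<open>\<alpha>\<^sub>i\<close> inverts the rising branch of \<open>c\<^sub>i\<close>, with the value
  \<open>w\<^sub>i\<^sup>l\<close> for every \<open>z\<close> below \<open>c\<^sub>i(w\<^sub>i\<^sup>l)\<close>, and \<open>\<beta>\<^sub>i\<close> inverts the falling branch in the same way.
  The series weight is continuous and increasing in every link weight. Hence the value \<open>z\<close> is
  feasible at \<open>W\<close> if and only if \<open>z \<le> M\<close> and \<open>A(z) \<le> W \<le> B(z)\<close>, where \<open>A\<close> and \<open>B\<close> are the
  series weights of the \<open>\<alpha>\<^sub>i\<close> and of the \<open>\<beta>\<^sub>i\<close> and \<open>M\<close> is the smallest of the link maxima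
  (\<open>feasible_values_eq\<close>). On \<open>{..M}\<close> the function \<open>A\<close> is increasing, strictly from
  \<open>m = min\<^sub>i c\<^sub>i(w\<^sub>i\<^sup>l)\<close> on; symmetrically \<open>B\<close> is decreasing, strictly from
  \<open>m' = min\<^sub>i c\<^sub>i(w\<^sub>i\<^sup>u)\<close> on. So the equivalent capacity is the inverse of \<open>A\<close> on \<open>{A m..A M}\<close>, is \<open>M\<close>
  on \<open>{A M..B M}\<close>, and is the inverse of \<open>B\<close> on \<open>{B M..B m'}\<close> (\<open>greatest_between_branches\<close>);
  this is the \<open>S0\<close> shape.

  The derivative condition of \<open>S1\<close> bounds the elasticity \<open>x \<psi>'(x) / \<psi>(x)\<close> from below by 1. For the
  inverse functions it says \<open>z \<alpha>\<^sub>i'(z) / \<alpha>\<^sub>i(z) \<le> 1\<close>, for both one-sided derivatives, where the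
  derivative is 0 below \<open>c\<^sub>i(w\<^sub>i\<^sup>l)\<close>. Differentiating \<open>1 / A = \<Sum>\<^sub>i 1 / \<alpha>\<^sub>i\<close> shows that the elasticity
  of \<open>A\<close> is the convex combination, with weights \<open>A / \<alpha>\<^sub>i\<close>, of the elasticities of the \<open>\<alpha>\<^sub>i\<close>.
  It is thus at most 1, with equality if and only if every link has equality
  (\<open>series_weight_elasticity\<close>).

  The equality case hides a difficulty. A minimum of two one-sided derivatives being \<open>\<psi>(x) / x\<close> leaves
  open which of the two attains it; were it the left one for one link and the right one for
  another, both one-sided elasticities of \<open>A\<close> would be less than 1. However, \<open>\<psi>(x) / x\<close> has one-sided
  derivatives with minimum 0 on \<open>{xo<..<a}\<close>, and such a function cannot increase
  (\<open>no_increase_if_min_derivative_nonpos\<close>). Therefore the right derivative of \<open>\<psi>\<close> is always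
  \<open>\<psi>(x) / x\<close> on \<open>{xo..<a}\<close> (\<open>right_derivative_eq_ratio\<close>), and the right derivatives of all links attain
  equality together as soon as \<open>z\<close> has passed the largest of the values \<open>c\<^sub>i(xo\<^sub>i)\<close>. Below that
  value some link is strict on both sides, and so is \<open>A\<close>.
\<close>
section \<open>Functions with vanishing minimum of the one-sided derivatives\<close>

text \<open>
  A local minimum value is the infimum of \<open>f\<close> over some interval with rational endpoints.
\<close>
lemma countable_local_min_values:
  fixes f :: "real \<Rightarrow> real"
  shows "countable {f t |t. \<exists>e>0. \<forall>s. \<bar>s - t\<bar> < e \<longrightarrow> f t \<le> f s}" (is "countable ?V")
proof -
  have "?V \<subseteq> (\<lambda>(p, q). Inf (f ` {real_of_rat p<..<real_of_rat q})) ` UNIV"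
  proof
    fix v assume "v \<in> ?V"
    then obtain t e where v: "v = f t" and e: "e > 0" "\<And>s. \<bar>s - t\<bar> < e \<Longrightarrow> f t \<le> f s"
      by auto
    obtain p where p: "t - e < real_of_rat p" "real_of_rat p < t"
      using of_rat_dense[of "t - e" t] e by auto
    obtain q where q: "t < real_of_rat q" "real_of_rat q < t + e"
      using of_rat_dense[of t "t + e"] e by auto
    have "Inf (f ` {real_of_rat p<..<real_of_rat q}) = f t"
      by (rule cInf_eq_minimum) (use p q e in auto)
    then show "v \<in> (\<lambda>(p, q). Inf (f ` {real_of_rat p<..<real_of_rat q})) ` UNIV"
      unfolding v by (intro image_eqI[of _ _ "(p, q)"]) auto
  qed
  then show ?thesis
    by (rule countable_subset) auto
qed

text \<open>
  A nonpositive left derivative at a kink is compatible with an increase to its right, so the points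
  of an increase must be counted. Subtracting a small slope \<open>k\<close> gives \<open>h\<close> with \<open>h x < h y\<close>, and every value \<open>v\<close> in between
  has a last point \<open>t\<close> with \<open>h t = v\<close>. There the right derivative of \<open>g\<close> is at least \<open>k > 0\<close>, so
  the left one is nonpositive and that of \<open>h\<close> is negative: \<open>t\<close> is a local minimum of \<open>h\<close>. The local
  minimum values of \<open>h\<close> would then fill an interval.
\<close>
lemma no_increase_if_min_derivative_nonpos:
  fixes g :: "real \<Rightarrow> real"
  assumes "x \<le> y" and cont: "continuous_on {x..y} g"
    and der: "\<And>t. x < t \<Longrightarrow> t < y \<Longrightarrow>
      \<exists>dl dr. (g has_real_derivative dl) (at_left t) \<and> (g has_real_derivative dr) (at_right t) \<and>
              min dl dr \<le> 0"
  shows "g y \<le> g x"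
proof (rule ccontr)
  assume "\<not> g y \<le> g x"
  then have gxy: "g x < g y" and xy: "x < y"
    using \<open>x \<le> y\<close> by (auto simp: order.order_iff_strict)
  \<comment> \<open>Half of the mean slope leaves \<open>h\<close> with an increase from \<open>x\<close> to \<open>y\<close>.\<close>
  define k where "k = (g y - g x) / (2 * (y - x))"
  have k: "k > 0" using gxy xy by (simp add: k_def)
  have ky: "k * (y - x) = (g y - g x) / 2" using xy unfolding k_def by (simp add: divide_simps)
  define h where "h = (\<lambda>t. g t - k * t)"
  have hxy: "h x < h y"
    using ky gxy by (simp add: h_def algebra_simps)
  have conth: "continuous_on {x..y} h"
    unfolding h_def by (intro continuous_intros cont)
  have "{h x<..<h y} \<subseteq> {h t |t. \<exists>e>0. \<forall>s. \<bar>s - t\<bar> < e \<longrightarrow> h t \<le> h s}"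
  proof
    fix v assume v: "v \<in> {h x<..<h y}"
    define S where "S = {x..y} \<inter> h -` {..v}"
    have "compact S"
      unfolding S_def compact_eq_bounded_closed
      using continuous_closed_preimage[OF conth, of "{..v}"]
      by (auto intro: bounded_subset[of "{x..y}"])
    moreover have "x \<in> S" using v xy by (auto simp: S_def)
    ultimately obtain t where t: "t \<in> S" "\<And>s. s \<in> S \<Longrightarrow> s \<le> t"
      using compact_attains_sup[of S] by auto
    have ty: "t < y" using t(1) v by (auto simp: S_def order.order_iff_strict)
    have after: "h s > v" if "t < s" "s \<le> y" for s
      using t(2)[of s] that t(1) by (force simp: S_def)
    have "continuous_on {t..y} h"
      by (rule continuous_on_subset[OF conth]) (use t in \<open>auto simp: S_def\<close>)
    then obtain s where "t \<le> s" "s \<le> y" "h s = v"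
      using IVT'[of h t v y] t(1) v ty by (auto simp: S_def)
    with after[of s] have ht: "h t = v" by (cases "s = t") auto
    have xt: "x < t" using t(1) ht v by (auto simp: S_def order.order_iff_strict)
    obtain dl dr where d: "(g has_real_derivative dl) (at_left t)"
      "(g has_real_derivative dr) (at_right t)" "min dl dr \<le> 0"
      using der[OF xt ty] by blast
    have hd: "(h has_real_derivative dl - k) (at_left t)" "(h has_real_derivative dr - k) (at_right t)"
      unfolding h_def using d by (auto intro!: derivative_eq_intros)
    have "\<not> dr - k < 0"
    proof
      assume "dr - k < 0"
      from has_real_derivative_neg_dec_right[OF hd(2) this] obtain e
        where e: "e > 0" "\<And>u. u > 0 \<Longrightarrow> u < e \<Longrightarrow> h (t + u) < h t" by auto
      define u where "u = min (e / 2) (y - t)"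
      have "u > 0" "u < e" "t + u \<le> y" using e(1) ty by (auto simp: u_def)
      then show False using e(2)[of u] after[of "t + u"] ht by auto
    qed
    then have "dl - k < 0" using d(3) k by (auto simp: min_def split: if_splits)
    from has_real_derivative_neg_dec_left[OF hd(1) this] obtain e
      where e: "e > 0" "\<And>u. u > 0 \<Longrightarrow> u < e \<Longrightarrow> h t < h (t - u)" by auto
    have "h t \<le> h s" if s: "\<bar>s - t\<bar> < min e (y - t)" for s
    proof -
      consider "s < t" | "s = t" | "s > t" by linarith
      then show ?thesis
        by cases (use e(2)[of "t - s"] after[of s] ht s in auto)
    qed
    moreover have "min e (y - t) > 0" using e ty by auto
    ultimately show "v \<in> {h t |t. \<exists>e>0. \<forall>s. \<bar>s - t\<bar> < e \<longrightarrow> h t \<le> h s}"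
      using ht by blast
  qed
  then have "countable {h x<..<h y}"
    using countable_local_min_values[of h] countable_subset by blast
  then show False using uncountable_open_interval[of "h x" "h y"] hxy by auto
qed

text \<open>
  The ratio \<open>\<psi> t / t\<close> has one-sided derivatives with minimum 0, hence does not increase, while its
  right derivative is nonnegative.
\<close>
lemma right_derivative_eq_ratio:
  fixes \<psi> :: "real \<Rightarrow> real"
  assumes xl: "0 < xl" and cont: "continuous_on {xl..a} \<psi>" and xo: "xl \<le> xo"
    and eq: "\<And>x. xo \<le> x \<Longrightarrow> x < a \<Longrightarrow> is_min_deriv xl \<psi> x (\<psi> x / x)"
    and x: "xo \<le> x" "x < a"
  shows "(\<psi> has_real_derivative \<psi> x / x) (at_right x)"
proof (cases "x = xl")
  case True
  then show ?thesis using eq[OF x] by (simp add: is_min_deriv_def)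
next
  case False
  then obtain dl dr where d: "(\<psi> has_real_derivative dr) (at_right x)" "\<psi> x / x = min dl dr"
    using eq[OF x] unfolding is_min_deriv_def by auto
  define g where "g = (\<lambda>t. \<psi> t / t)"
  have x0: "x > 0" using xl xo x by auto
  have dec: "g y \<le> g x" if y: "x < y" "y < a" for y
  proof (rule no_increase_if_min_derivative_nonpos[of x y g])
    show "x \<le> y" using y by simp
    show "continuous_on {x..y} g"
      unfolding g_def
      by (intro continuous_intros continuous_on_subset[OF cont]) (use x y xo x0 in auto)
    fix t assume t: "x < t" "t < y"
    then have t0: "t > 0" "t \<noteq> xl" "xo \<le> t" "t < a" using x0 x xo y by auto
    obtain el er where e: "(\<psi> has_real_derivative el) (at_left t)"
      "(\<psi> has_real_derivative er) (at_right t)" "\<psi> t / t = min el er"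
      using eq[OF t0(3,4)] t0(2) unfolding is_min_deriv_def by auto
    have quot: "(g has_real_derivative (e - \<psi> t / t) / t) F"
      if "(\<psi> has_real_derivative e) F" "F = at t within T" for e F T
      using that t0(1) unfolding g_def
      by (auto intro!: derivative_eq_intros simp: field_simps)
    show "\<exists>dl dr. (g has_real_derivative dl) (at_left t) \<and> (g has_real_derivative dr) (at_right t) \<and>
              min dl dr \<le> 0"
    proof (intro exI conjI)
      show "(g has_real_derivative (el - \<psi> t / t) / t) (at_left t)"
        "(g has_real_derivative (er - \<psi> t / t) / t) (at_right t)"
        by (rule quot[OF e(1) refl] quot[OF e(2) refl])+
      show "min ((el - \<psi> t / t) / t) ((er - \<psi> t / t) / t) \<le> 0"
        using e(3) t0(1) by (auto simp: min_def split: if_splits)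
    qed
  qed
  have gd: "(g has_real_derivative (dr - \<psi> x / x) / x) (at_right x)"
    using d(1) x0 unfolding g_def
    by (auto intro!: derivative_eq_intros simp: field_simps)
  have "\<not> (dr - \<psi> x / x) / x > 0"
  proof
    assume "(dr - \<psi> x / x) / x > 0"
    from has_real_derivative_pos_inc_right[OF gd this] obtain e
      where e: "e > 0" "\<And>u. u > 0 \<Longrightarrow> u < e \<Longrightarrow> g x < g (x + u)" by auto
    define u where "u = min (e / 2) ((a - x) / 2)"
    have "u > 0" "u < e" "x + u < a" using e(1) x by (auto simp: u_def min_def field_simps)
    then show False using e(2)[of u] dec[of "x + u"] by auto
  qed
  then have "dr \<le> \<psi> x / x" using x0 by (simp add: zero_less_divide_iff)
  with d show ?thesis by (simp add: min_def split: if_splits)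
qed

section \<open>Inverting the rising branch\<close>

text \<open>
  The sets \<open>S\<close> and \<open>T\<close> select a side: the inverse of a rising function maps a right (left)
  neighbourhood to a right (left) neighbourhood.
\<close>
lemma has_real_derivative_inverse_within:
  fixes f g :: "real \<Rightarrow> real"
  assumes f: "(f has_real_derivative d) (at (g y) within S)" and "d \<noteq> 0"
    and lim: "filterlim g (at (g y) within S) (at y within T)"
    and inv: "f (g y) = y" "\<forall>\<^sub>F t in at y within T. f (g t) = t"
  shows "(g has_real_derivative inverse d) (at y within T)"
proof -
  have "((\<lambda>x. (f x - f (g y)) / (x - g y)) \<longlongrightarrow> d) (at (g y) within S)"
    using f by (simp add: has_field_derivative_iff)
  from filterlim_compose[OF this lim]
  have "((\<lambda>t. inverse ((f (g t) - y) / (g t - g y))) \<longlongrightarrow> inverse d) (at y within T)"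
    using \<open>d \<noteq> 0\<close> inv(1) by (intro tendsto_inverse) auto
  then have "((\<lambda>t. (g t - g y) / (t - y)) \<longlongrightarrow> inverse d) (at y within T)"
    by (rule Lim_transform_eventually)
       (use inv(2) in \<open>auto elim!: eventually_mono simp: inverse_eq_divide\<close>)
  then show ?thesis by (simp add: has_field_derivative_iff)
qed


text \<open>
  For a function rising on \<open>{xl..a}\<close> this is the first point with value at least \<open>z\<close>. The maximum
  clamps all \<open>z\<close> below the starting value to the left end, so that the function is continuous and
  meaningful on the whole of \<open>{..\<psi> a}\<close>.
\<close>
definition first_reach :: "(real \<Rightarrow> real) \<Rightarrow> real \<Rightarrow> real \<Rightarrow> real \<Rightarrow> real" where
  "first_reach \<psi> xl a z = inv_into {xl..a} \<psi> (max (\<psi> xl) z)"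

text \<open>
  The locale serves three kinds of functions: the rising part of a capacity function, its falling
  part after reflection of the argument, and the branches \<open>A\<close> and \<open>- B\<close> of the network, whose
  inverses are the branches of the equivalent capacity.
\<close>
locale rising_branch =
  fixes \<psi> :: "real \<Rightarrow> real" and xl a :: real
  assumes xl_le_a: "xl \<le> a"
    and cont: "continuous_on {xl..a} \<psi>"
    and strict_mono: "strict_mono_on {xl..a} \<psi>"
begin

abbreviation "\<alpha> \<equiv> first_reach \<psi> xl a"

lemma le_iff: "x \<in> {xl..a} \<Longrightarrow> y \<in> {xl..a} \<Longrightarrow> \<psi> x \<le> \<psi> y \<longleftrightarrow> x \<le> y"
  using strict_mono_on_leD[OF strict_mono] strict_mono_onD[OF strict_mono, of y x]
  by (meson linorder_not_le)

lemma image_eq: "\<psi> ` {xl..a} = {\<psi> xl..\<psi> a}"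
proof
  show "\<psi> ` {xl..a} \<subseteq> {\<psi> xl..\<psi> a}"
    using xl_le_a by (auto simp: le_iff)
  show "{\<psi> xl..\<psi> a} \<subseteq> \<psi> ` {xl..a}"
    using IVT'[OF _ _ xl_le_a cont] by force
qed

lemma max_mem_image: "z \<le> \<psi> a \<Longrightarrow> max (\<psi> xl) z \<in> \<psi> ` {xl..a}"
  using xl_le_a by (auto simp: image_eq le_iff)

lemma first_reach_mem: "z \<le> \<psi> a \<Longrightarrow> \<alpha> z \<in> {xl..a}"
  unfolding first_reach_def by (rule inv_into_into[OF max_mem_image])

lemma value_first_reach: "z \<le> \<psi> a \<Longrightarrow> \<psi> (\<alpha> z) = max (\<psi> xl) z"
  unfolding first_reach_def by (rule f_inv_into_f[OF max_mem_image])

lemma first_reach_le_iff: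
  assumes "z \<le> \<psi> a" "x \<in> {xl..a}"
  shows "\<alpha> z \<le> x \<longleftrightarrow> z \<le> \<psi> x"
proof -
  have "\<alpha> z \<le> x \<longleftrightarrow> \<psi> (\<alpha> z) \<le> \<psi> x"
    using le_iff[OF first_reach_mem[OF assms(1)] assms(2)] by simp
  moreover have "\<psi> xl \<le> \<psi> x" using assms(2) by (auto simp: le_iff)
  ultimately show ?thesis using value_first_reach[OF assms(1)] by simp
qed

lemma first_reach_value: "x \<in> {xl..a} \<Longrightarrow> \<alpha> (\<psi> x) = x"
  using first_reach_le_iff[of "\<psi> x" x] first_reach_mem[of "\<psi> x"] value_first_reach[of "\<psi> x"]
    le_iff[of x "\<alpha> (\<psi> x)"] xl_le_a
  by (auto simp: le_iff)

lemma first_reach_below: "z \<le> \<psi> xl \<Longrightarrow> \<alpha> z = xl"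
  using first_reach_value[of xl] xl_le_a by (simp add: first_reach_def max_absorb1)

lemma mono_first_reach: "mono_on {..\<psi> a} \<alpha>"
proof (rule mono_onI)
  fix y z assume yz: "y \<in> {..\<psi> a}" "z \<in> {..\<psi> a}" "y \<le> z"
  then show "\<alpha> y \<le> \<alpha> z"
    using first_reach_le_iff[of y "\<alpha> z"] first_reach_mem[of z] value_first_reach[of z] by auto
qed

lemma first_reach_less:
  assumes "y < z" "\<psi> xl < z" "z \<le> \<psi> a"
  shows "\<alpha> y < \<alpha> z"
  using first_reach_le_iff[of z "\<alpha> y"] first_reach_mem[of y] value_first_reach[of y] assms by auto

lemma continuous_first_reach: "continuous_on {..\<psi> a} \<alpha>"
proof -
  have "continuous_on (\<psi> ` {xl..a}) (inv_into {xl..a} \<psi>)"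
    using strict_mono_on_imp_inj_on[OF strict_mono]
    by (intro continuous_on_inv cont) auto
  then show ?thesis
    unfolding first_reach_def
    by (rule continuous_on_compose2) (auto intro!: continuous_intros max_mem_image)
qed

text \<open>
  At the starting value \<open>\<psi> xl\<close> only the right derivative of the inverse is governed by \<open>\<psi>\<close>, because the clamped
  inverse is constant to the left of it. The condition on \<open>T\<close> expresses this.
\<close>
lemma first_reach_derivative:
  assumes d: "(\<psi> has_real_derivative d) (at (\<alpha> z) within S)" "d \<noteq> 0"
    and z: "\<psi> xl \<le> z" "z < \<psi> a"
    and T: "z = \<psi> xl \<Longrightarrow> T \<subseteq> {z<..}" "T \<subseteq> - {z}"
    and S: "\<And>t. t \<in> T \<Longrightarrow> \<psi> xl < t \<Longrightarrow> t < \<psi> a \<Longrightarrow> \<alpha> t \<in> S"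
  shows "(\<alpha> has_real_derivative inverse d) (at z within T)"
proof (rule has_real_derivative_inverse_within[where g = \<alpha> and y = z, OF d])
  have ev: "\<forall>\<^sub>F t in at z within T. \<psi> xl < t \<and> t < \<psi> a \<and> t \<in> T"
  proof -
    have "\<forall>\<^sub>F t in at z within T. t < \<psi> a"
      using z(2) by (intro order_tendstoD(2)[OF tendsto_ident_at])
    moreover have "\<forall>\<^sub>F t in at z within T. \<psi> xl < t"
    proof (cases "z = \<psi> xl")
      case True
      with T(1) show ?thesis by (auto simp: eventually_at_filter intro!: always_eventually)
    next
      case False
      then show ?thesis using z(1) by (intro order_tendstoD(1)[OF tendsto_ident_at]) auto
    qed
    moreover have "\<forall>\<^sub>F t in at z within T. t \<in> T"
      by (auto simp: eventually_at_filter)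
    ultimately show ?thesis by eventually_elim auto
  qed
  have "(\<alpha> \<longlongrightarrow> \<alpha> z) (at z)"
  proof -
    have "continuous_on {..<\<psi> a} \<alpha>"
      by (rule continuous_on_subset[OF continuous_first_reach]) auto
    then have "continuous (at z within {..<\<psi> a}) \<alpha>"
      using z(2) by (simp add: continuous_on_eq_continuous_within)
    then show ?thesis
      using z(2) at_within_open[of z "{..<\<psi> a}"] by (simp add: continuous_within)
  qed
  then have "(\<alpha> \<longlongrightarrow> \<alpha> z) (at z within T)"
    by (rule filterlim_mono) (auto intro: at_le)
  moreover have "\<forall>\<^sub>F t in at z within T. \<alpha> t \<in> S - {\<alpha> z}"
    using ev
  proof eventually_elim
    case (elim t)
    with T(2) have "t \<noteq> z" by auto
    then have "\<alpha> t \<noteq> \<alpha> z"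
      using first_reach_less[of t z] first_reach_less[of z t] elim z by (cases "t < z") auto
    then show ?case using S elim by auto
  qed
  ultimately show "filterlim \<alpha> (at (\<alpha> z) within S) (at z within T)"
    by (auto simp: filterlim_at elim: eventually_mono)
  show "\<psi> (\<alpha> z) = z" using value_first_reach[of z] z by simp
  show "\<forall>\<^sub>F t in at z within T. \<psi> (\<alpha> t) = t"
    using ev by eventually_elim (simp add: value_first_reach)
qed

end

section \<open>The derivative condition for inverse functions\<close>

text \<open>
  The \<open>S1\<close> derivative condition transported to the inverse \<open>\<alpha>\<close> of a rising branch with values from
  \<open>m\<close> to \<open>M\<close> and value \<open>k\<close> at the transition from strict inequality to equality. The bound
  \<open>p \<le> \<alpha> z / z\<close> says that the elasticity of \<open>\<alpha>\<close> is at most 1. Equality is asked for the right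
  derivative only; in this form the condition is stable under series connection. Positivity of the
  derivative, needed to invert once more, starts at \<open>m\<close> on the right of a point but strictly above \<open>m\<close>
  on its left.
\<close>
definition inverse_profile :: "real \<Rightarrow> real \<Rightarrow> real \<Rightarrow> (real \<Rightarrow> real) \<Rightarrow> bool" where
  "inverse_profile m k M \<alpha> \<longleftrightarrow> (\<forall>z. 0 < z \<and> z < M \<longrightarrow>
     (\<exists>p. (\<alpha> has_real_derivative p) (at_right z) \<and> 0 \<le> p \<and> p \<le> \<alpha> z / z \<and>
          (m \<le> z \<longrightarrow> 0 < p) \<and> (z < k \<longrightarrow> p < \<alpha> z / z) \<and> (k \<le> z \<longrightarrow> p = \<alpha> z / z)) \<and>
     (\<exists>p. (\<alpha> has_real_derivative p) (at_left z) \<and> 0 \<le> p \<and> p \<le> \<alpha> z / z \<and>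
          (m < z \<longrightarrow> 0 < p) \<and> (z < k \<longrightarrow> p < \<alpha> z / z)))"

text \<open>
  Reciprocals turn \<open>d \<ge> \<psi> x / x\<close> into \<open>p \<le> \<alpha> z / z\<close> at \<open>z = \<psi> x\<close>. In the equality range the right
  derivative is the one that attains the minimum, by \<open>right_derivative_eq_ratio\<close>.
\<close>
lemma inverse_profile_first_reach:
  fixes \<psi> :: "real \<Rightarrow> real"
  assumes xl: "0 < xl" and rb: "rising_branch \<psi> xl a"
    and xo: "xo \<in> {xl..a}"
    and gt: "\<And>x. xl \<le> x \<Longrightarrow> x < xo \<Longrightarrow> \<exists>d. is_min_deriv xl \<psi> x d \<and> \<psi> x / x < d"
    and eq: "\<And>x. xo \<le> x \<Longrightarrow> x < a \<Longrightarrow> is_min_deriv xl \<psi> x (\<psi> x / x)"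
  shows "inverse_profile (\<psi> xl) (\<psi> xo) (\<psi> a) (first_reach \<psi> xl a)"
proof -
  interpret rising_branch \<psi> xl a by (rule rb)
  note mono = strict_mono_onD[OF strict_mono]
  have deriv: "(\<exists>d. (\<psi> has_real_derivative d) (at_right x) \<and> \<psi> x / x \<le> d \<and>
                 (x < xo \<longrightarrow> \<psi> x / x < d) \<and> (xo \<le> x \<longrightarrow> d = \<psi> x / x)) \<and>
               (xl < x \<longrightarrow> (\<exists>d. (\<psi> has_real_derivative d) (at_left x) \<and> \<psi> x / x \<le> d \<and>
                 (x < xo \<longrightarrow> \<psi> x / x < d)))"
    if x: "xl \<le> x" "x < a" for x
  proof (cases "x < xo")
    case True
    then obtain d where "is_min_deriv xl \<psi> x d" "\<psi> x / x < d" using gt x by blast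
    then show ?thesis using True by (auto simp: is_min_deriv_def split: if_splits)
  next
    case False
    then have "xo \<le> x" by simp
    have r: "(\<psi> has_real_derivative \<psi> x / x) (at_right x)"
      by (rule right_derivative_eq_ratio[OF xl cont _ eq \<open>xo \<le> x\<close> x(2)]) (use xo in auto)
    show ?thesis
      using r eq[OF \<open>xo \<le> x\<close> x(2)] False by (auto simp: is_min_deriv_def split: if_splits)
  qed
  \<comment> \<open>Below the starting value the first point stays at the left end.\<close>
  have flat: "(\<alpha> has_real_derivative 0) (at z within T)"
    if z: "z \<le> \<psi> xl" and ev: "\<forall>\<^sub>F t in at z within T. t \<le> \<psi> xl" for z T
  proof -
    have "\<forall>\<^sub>F t in at z within T. (\<alpha> t - \<alpha> z) / (t - z) = 0"
      using ev by eventually_elim (simp add: first_reach_below z)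
    then show ?thesis
      unfolding has_field_derivative_iff by (rule tendsto_eventually)
  qed
  show ?thesis
    unfolding inverse_profile_def
  proof (intro allI impI conjI)
    fix z assume z: "0 < z \<and> z < \<psi> a"
    have az: "\<alpha> z \<in> {xl..a}" "\<psi> (\<alpha> z) = max (\<psi> xl) z"
      using first_reach_mem[of z] value_first_reach[of z] z by auto
    have a0: "\<alpha> z > 0" using az xl by auto
    have ratio_pos: "0 < \<alpha> z / z" using a0 z by auto
    have axo: "\<alpha> z < xo \<longleftrightarrow> z < \<psi> xo" if "\<psi> xl \<le> z"
      using le_iff[of xo "\<alpha> z"] az xo that by auto
    have aa: "\<alpha> z < a" if "\<psi> xl \<le> z"
      using le_iff[of a "\<alpha> z"] az xl_le_a that z by auto
    have axl: "xl < \<alpha> z" if "\<psi> xl < z"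
      using le_iff[of "\<alpha> z" xl] az xl_le_a that z by auto
    have kxl: "\<psi> xl \<le> \<psi> xo" using xo by (auto simp: le_iff)
    have inv_le: "inverse d \<le> \<alpha> z / z" if "z / \<alpha> z \<le> d" for d
      using le_imp_inverse_le[OF that] a0 z by auto
    have inv_less: "inverse d < \<alpha> z / z" if "z / \<alpha> z < d" for d
      using less_imp_inverse_less[OF that] a0 z by auto
    have d_pos: "0 < d" if "z / \<alpha> z \<le> d" for d
      using that a0 z by (meson divide_pos_pos less_le_trans)
    show "\<exists>p. (\<alpha> has_real_derivative p) (at_right z) \<and> 0 \<le> p \<and> p \<le> \<alpha> z / z \<and>
          (\<psi> xl \<le> z \<longrightarrow> 0 < p) \<and> (z < \<psi> xo \<longrightarrow> p < \<alpha> z / z) \<and> (\<psi> xo \<le> z \<longrightarrow> p = \<alpha> z / z)"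
    proof (cases "\<psi> xl \<le> z")
      case True
      have v: "\<psi> (\<alpha> z) = z" using az True by simp
      obtain d where d: "(\<psi> has_real_derivative d) (at_right (\<alpha> z))" "z / \<alpha> z \<le> d"
        "z < \<psi> xo \<Longrightarrow> z / \<alpha> z < d" "\<psi> xo \<le> z \<Longrightarrow> d = z / \<alpha> z"
        using deriv[of "\<alpha> z"] az aa[OF True] axo[OF True] unfolding v by force
      have "(\<alpha> has_real_derivative inverse d) (at_right z)"
        by (rule first_reach_derivative[OF d(1)])
           (use d_pos[OF d(2)] True z first_reach_less in auto)
      then show ?thesis
        using d inv_le inv_less d_pos[OF d(2)] by (intro exI[of _ "inverse d"]) auto
    next
      case False
      have "(\<alpha> has_real_derivative 0) (at_right z)"
        by (rule flat, use False in simp,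
            rule eventually_mono[OF order_tendstoD(2)[OF tendsto_ident_at, of z "\<psi> xl"]])
           (use False in auto)
      then show ?thesis using False ratio_pos kxl by (intro exI[of _ 0]) auto
    qed
    show "\<exists>p. (\<alpha> has_real_derivative p) (at_left z) \<and> 0 \<le> p \<and> p \<le> \<alpha> z / z \<and>
          (\<psi> xl < z \<longrightarrow> 0 < p) \<and> (z < \<psi> xo \<longrightarrow> p < \<alpha> z / z)"
    proof (cases "\<psi> xl < z")
      case True
      have v: "\<psi> (\<alpha> z) = z" using az True by simp
      obtain d where d: "(\<psi> has_real_derivative d) (at_left (\<alpha> z))" "z / \<alpha> z \<le> d"
        "z < \<psi> xo \<Longrightarrow> z / \<alpha> z < d"
        using deriv[of "\<alpha> z"] az aa axo axl[OF True] True unfolding v by force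
      have "(\<alpha> has_real_derivative inverse d) (at_left z)"
        by (rule first_reach_derivative[OF d(1)])
           (use d_pos[OF d(2)] True z first_reach_less in auto)
      then show ?thesis
        using d inv_le inv_less d_pos[OF d(2)] by (intro exI[of _ "inverse d"]) auto
    next
      case False
      have "(\<alpha> has_real_derivative 0) (at_left z)"
        by (rule flat) (use False in \<open>auto simp: eventually_at_filter\<close>)
      then show ?thesis using False ratio_pos by (intro exI[of _ 0]) auto
    qed
  qed
qed


section \<open>Series weights\<close>
lemma series_weight_pos:
  assumes "n \<ge> 1" "\<And>i. i \<in> {1..n} \<Longrightarrow> 0 < w i"
  shows "0 < series_weight n w"
  using assms unfolding series_weight_def by (intro positive_imp_inverse_positive sum_pos) auto

lemma series_weight_mono:
  assumes "\<And>i. i \<in> {1..n} \<Longrightarrow> 0 < w i" "\<And>i. i \<in> {1..n} \<Longrightarrow> w i \<le> w' i"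
  shows "series_weight n w \<le> series_weight n w'"
proof (cases "n \<ge> 1")
  case True
  have pos: "0 < w' i" if "i \<in> {1..n}" for i using assms[OF that] by simp
  have "(\<Sum>i=1..n. 1 / w' i) \<le> (\<Sum>i=1..n. 1 / w i)"
    by (intro sum_mono) (use assms pos in \<open>simp add: frac_le\<close>)
  moreover have "0 < (\<Sum>i=1..n. 1 / w' i)" using True pos by (intro sum_pos) auto
  ultimately show ?thesis unfolding series_weight_def by (rule le_imp_inverse_le)
qed (simp add: series_weight_def)

lemma series_weight_strict_mono:
  assumes "\<And>i. i \<in> {1..n} \<Longrightarrow> 0 < w i" "\<And>i. i \<in> {1..n} \<Longrightarrow> w i \<le> w' i"
    and "j \<in> {1..n}" "w j < w' j"
  shows "series_weight n w < series_weight n w'"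
proof -
  have pos: "0 < w' i" if "i \<in> {1..n}" for i using assms(1,2)[OF that] by simp
  have "(\<Sum>i=1..n. 1 / w' i) < (\<Sum>i=1..n. 1 / w i)"
  proof (rule sum_strict_mono_ex1)
    show "\<exists>i\<in>{1..n}. 1 / w' i < 1 / w i"
      using assms pos by (intro bexI[of _ j]) (auto simp: frac_less2)
  qed (use assms pos in \<open>auto simp: frac_le\<close>)
  moreover have "0 < (\<Sum>i=1..n. 1 / w' i)" using assms(3) pos by (intro sum_pos) auto
  ultimately show ?thesis unfolding series_weight_def by (rule less_imp_inverse_less)
qed

lemma continuous_on_series_weight:
  fixes w :: "nat \<Rightarrow> real \<Rightarrow> real"
  assumes "n \<ge> 1" and "\<And>i. i \<in> {1..n} \<Longrightarrow> continuous_on S (w i)"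
    and pos: "\<And>i t. i \<in> {1..n} \<Longrightarrow> t \<in> S \<Longrightarrow> 0 < w i t"
  shows "continuous_on S (\<lambda>t. series_weight n (\<lambda>i. w i t))"
proof -
  have "(\<Sum>i=1..n. 1 / w i t) \<noteq> 0" if "t \<in> S" for t
    using sum_pos[of "{1..n}" "\<lambda>i. 1 / w i t"] assms(1) pos[OF _ that] by force
  moreover have "w i t \<noteq> 0" if "i \<in> {1..n}" "t \<in> S" for i t
    using pos[OF that] by simp
  ultimately show ?thesis
    unfolding series_weight_def by (intro continuous_intros assms(2) ballI) auto
qed

lemma series_weight_derivative:
  fixes w :: "nat \<Rightarrow> real \<Rightarrow> real"
  assumes "n \<ge> 1" and der: "\<And>i. i \<in> {1..n} \<Longrightarrow> (w i has_real_derivative p i) (at z within T)"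
    and pos: "\<And>i. i \<in> {1..n} \<Longrightarrow> 0 < w i z"
  shows "((\<lambda>t. series_weight n (\<lambda>i. w i t)) has_real_derivative
          (series_weight n (\<lambda>i. w i z))\<^sup>2 * (\<Sum>i=1..n. p i / (w i z)\<^sup>2)) (at z within T)"
proof -
  have S: "(\<Sum>i=1..n. 1 / w i z) \<noteq> 0"
    using sum_pos[of "{1..n}" "\<lambda>i. 1 / w i z"] assms(1) pos by force
  have "((\<lambda>t. 1 / w i t) has_real_derivative - (p i / (w i z)\<^sup>2)) (at z within T)"
    if "i \<in> {1..n}" for i
    using der[OF that] pos[OF that]
    by (auto intro!: derivative_eq_intros simp: field_simps power2_eq_square)
  then have "((\<lambda>t. \<Sum>i=1..n. 1 / w i t) has_real_derivative (\<Sum>i=1..n. - (p i / (w i z)\<^sup>2))) (at z within T)"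
    by (intro DERIV_sum)
  from DERIV_inverse'[OF this S] show ?thesis
    unfolding series_weight_def
    by (simp add: sum_negf power2_eq_square algebra_simps)
qed

text \<open>
  With \<open>e\<^sub>i = z p\<^sub>i / w\<^sub>i\<close> in \<open>{0..1}\<close> one has \<open>z D / W = \<Sum>\<^sub>i (W / w\<^sub>i) e\<^sub>i\<close>, a convex combination with
  positive weights. All claims follow by comparing with the case \<open>e\<^sub>i = 1\<close> for all \<open>i\<close>.
\<close>
lemma series_weight_elasticity:
  fixes w p :: "nat \<Rightarrow> real"
  assumes n: "n \<ge> 1" and z: "0 < z" and w: "\<And>i. i \<in> {1..n} \<Longrightarrow> 0 < w i"
    and p: "\<And>i. i \<in> {1..n} \<Longrightarrow> 0 \<le> p i \<and> p i \<le> w i / z"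
  defines "W \<equiv> series_weight n w"
  defines "D \<equiv> W\<^sup>2 * (\<Sum>i=1..n. p i / (w i)\<^sup>2)"
  shows "0 \<le> D" and "D \<le> W / z"
    and "\<exists>i\<in>{1..n}. 0 < p i \<Longrightarrow> 0 < D"
    and "\<exists>i\<in>{1..n}. p i < w i / z \<Longrightarrow> D < W / z"
    and "\<forall>i\<in>{1..n}. p i = w i / z \<Longrightarrow> D = W / z"
proof -
  have W: "W > 0" unfolding W_def using n w by (rule series_weight_pos)
  have nn: "0 \<le> p i / (w i)\<^sup>2" if "i \<in> {1..n}" for i using p[OF that] by simp
  show "0 \<le> D" unfolding D_def using nn by (intro mult_nonneg_nonneg sum_nonneg) auto
  have Wz: "W / z = W\<^sup>2 * (\<Sum>i=1..n. (w i / z) / (w i)\<^sup>2)"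
  proof -
    have "(\<Sum>i=1..n. (w i / z) / (w i)\<^sup>2) = (\<Sum>i=1..n. 1 / w i) / z"
      unfolding sum_divide_distrib
      by (intro sum.cong) (use w in \<open>force simp: power2_eq_square\<close>)+
    also have "(\<Sum>i=1..n. 1 / w i) = 1 / W"
      by (simp add: W_def series_weight_def inverse_eq_divide)
    finally show ?thesis using W by (simp add: power2_eq_square)
  qed
  have le: "p i / (w i)\<^sup>2 \<le> (w i / z) / (w i)\<^sup>2" if "i \<in> {1..n}" for i
    using p[OF that] by (intro divide_right_mono) auto
  show "D \<le> W / z"
    unfolding Wz D_def by (intro mult_left_mono sum_mono le) auto
  show "0 < D" if "\<exists>i\<in>{1..n}. 0 < p i"
  proof -
    from that obtain j where "j \<in> {1..n}" "0 < p j" by blast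
    then have "0 < (\<Sum>i=1..n. p i / (w i)\<^sup>2)"
      using nn w[of j] by (intro sum_pos2[of _ j]) auto
    then show ?thesis using W by (simp add: D_def)
  qed
  show "D < W / z" if "\<exists>i\<in>{1..n}. p i < w i / z"
  proof -
    have "(\<Sum>i=1..n. p i / (w i)\<^sup>2) < (\<Sum>i=1..n. (w i / z) / (w i)\<^sup>2)"
    proof (rule sum_strict_mono_ex1)
      from that obtain j where "j \<in> {1..n}" "p j < w j / z" by blast
      then show "\<exists>i\<in>{1..n}. p i / (w i)\<^sup>2 < (w i / z) / (w i)\<^sup>2"
        using w[of j] by (intro bexI[of _ j] divide_strict_right_mono) auto
    qed (use le in auto)
    then show ?thesis unfolding Wz D_def using W by (intro mult_strict_left_mono) auto
  qed
  show "D = W / z" if "\<forall>i\<in>{1..n}. p i = w i / z"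
    unfolding Wz D_def using that by simp
qed

text \<open>
  A single link already moving makes the network weight move, whence the minimum of the \<open>m i\<close>; and a
  single strict link makes the network strict, whence the maximum of the \<open>k i\<close>.
\<close>
lemma inverse_profile_series_weight:
  fixes \<alpha> :: "nat \<Rightarrow> real \<Rightarrow> real"
  assumes n: "n \<ge> 1"
    and prof: "\<And>i. i \<in> {1..n} \<Longrightarrow> inverse_profile (m i) (k i) (M i) (\<alpha> i)"
    and le: "\<And>i. i \<in> {1..n} \<Longrightarrow> M0 \<le> M i"
    and pos: "\<And>i z. i \<in> {1..n} \<Longrightarrow> z \<le> M0 \<Longrightarrow> 0 < \<alpha> i z"
  shows "inverse_profile (Min (m ` {1..n})) (Max (k ` {1..n})) M0 (\<lambda>z. series_weight n (\<lambda>i. \<alpha> i z))"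
  unfolding inverse_profile_def
proof (intro allI impI conjI)
  fix z assume z: "0 < z \<and> z < M0"
  let ?W = "series_weight n (\<lambda>i. \<alpha> i z)"
  have ne: "finite {1..n}" "{1..n} \<noteq> {}" using n by auto
  have w: "0 < \<alpha> i z" if "i \<in> {1..n}" for i using pos[OF that] z by simp
  have zi: "0 < z \<and> z < M i" if "i \<in> {1..n}" for i using le[OF that] z by simp
  have m: "\<exists>i\<in>{1..n}. m i \<le> z" if "Min (m ` {1..n}) \<le> z" 
    using that ne by (subst (asm) Min_le_iff) auto
  have m': "\<exists>i\<in>{1..n}. m i < z" if "Min (m ` {1..n}) < z"
    using that ne by (subst (asm) Min_less_iff) auto
  have k: "\<exists>i\<in>{1..n}. z < k i" if "z < Max (k ` {1..n})"
    using that ne by (subst (asm) Max_gr_iff) auto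
  have k': "\<forall>i\<in>{1..n}. k i \<le> z" if "Max (k ` {1..n}) \<le> z"
    using that ne by (subst (asm) Max_le_iff) auto
  let ?D = "\<lambda>p. ?W\<^sup>2 * (\<Sum>i=1..n. p i / (\<alpha> i z)\<^sup>2)"
  note deriv = series_weight_derivative[where w = \<alpha>, OF n _ w]
  have elast: "0 \<le> ?D p" "?D p \<le> ?W / z" "\<exists>i\<in>{1..n}. 0 < p i \<Longrightarrow> 0 < ?D p"
    "\<exists>i\<in>{1..n}. p i < \<alpha> i z / z \<Longrightarrow> ?D p < ?W / z"
    "\<forall>i\<in>{1..n}. p i = \<alpha> i z / z \<Longrightarrow> ?D p = ?W / z"
    if "\<And>i. i \<in> {1..n} \<Longrightarrow> 0 \<le> p i \<and> p i \<le> \<alpha> i z / z" for p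
    using series_weight_elasticity[of n z "\<lambda>i. \<alpha> i z" p, OF n _ w that] z by blast+
  have "\<forall>i\<in>{1..n}. \<exists>p. (\<alpha> i has_real_derivative p) (at_right z) \<and> 0 \<le> p \<and> p \<le> \<alpha> i z / z \<and>
          (m i \<le> z \<longrightarrow> 0 < p) \<and> (z < k i \<longrightarrow> p < \<alpha> i z / z) \<and> (k i \<le> z \<longrightarrow> p = \<alpha> i z / z)"
    using prof zi unfolding inverse_profile_def by blast
  then obtain p where p: "\<And>i. i \<in> {1..n} \<Longrightarrow> (\<alpha> i has_real_derivative p i) (at_right z) \<and>
          0 \<le> p i \<and> p i \<le> \<alpha> i z / z \<and>
          (m i \<le> z \<longrightarrow> 0 < p i) \<and> (z < k i \<longrightarrow> p i < \<alpha> i z / z) \<and> (k i \<le> z \<longrightarrow> p i = \<alpha> i z / z)"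
    by metis
  show "\<exists>p. ((\<lambda>z. series_weight n (\<lambda>i. \<alpha> i z)) has_real_derivative p) (at_right z) \<and>
          0 \<le> p \<and> p \<le> ?W / z \<and> (Min (m ` {1..n}) \<le> z \<longrightarrow> 0 < p) \<and>
          (z < Max (k ` {1..n}) \<longrightarrow> p < ?W / z) \<and> (Max (k ` {1..n}) \<le> z \<longrightarrow> p = ?W / z)"
  proof (intro exI[of _ "?D p"] conjI impI)
    have p': "0 \<le> p i \<and> p i \<le> \<alpha> i z / z" if "i \<in> {1..n}" for i using p[OF that] by blast
    show "((\<lambda>z. series_weight n (\<lambda>i. \<alpha> i z)) has_real_derivative ?D p) (at_right z)"
      by (rule deriv) (use p in blast)
    show "0 \<le> ?D p" "?D p \<le> ?W / z" by (rule elast(1)[OF p'] elast(2)[OF p'], assumption)+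
    show "0 < ?D p" if "Min (m ` {1..n}) \<le> z"
      by (rule elast(3)[OF p']) (use m[OF that] p in blast)+
    show "?D p < ?W / z" if "z < Max (k ` {1..n})"
      by (rule elast(4)[OF p']) (use k[OF that] p in blast)+
    show "?D p = ?W / z" if "Max (k ` {1..n}) \<le> z"
      by (rule elast(5)[OF p']) (use k'[OF that] p in blast)+
  qed
  have "\<forall>i\<in>{1..n}. \<exists>p. (\<alpha> i has_real_derivative p) (at_left z) \<and> 0 \<le> p \<and> p \<le> \<alpha> i z / z \<and>
          (m i < z \<longrightarrow> 0 < p) \<and> (z < k i \<longrightarrow> p < \<alpha> i z / z)"
    using prof zi unfolding inverse_profile_def by blast
  then obtain q where q: "\<And>i. i \<in> {1..n} \<Longrightarrow> (\<alpha> i has_real_derivative q i) (at_left z) \<and>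
          0 \<le> q i \<and> q i \<le> \<alpha> i z / z \<and> (m i < z \<longrightarrow> 0 < q i) \<and> (z < k i \<longrightarrow> q i < \<alpha> i z / z)"
    by metis
  show "\<exists>p. ((\<lambda>z. series_weight n (\<lambda>i. \<alpha> i z)) has_real_derivative p) (at_left z) \<and>
          0 \<le> p \<and> p \<le> ?W / z \<and> (Min (m ` {1..n}) < z \<longrightarrow> 0 < p) \<and>
          (z < Max (k ` {1..n}) \<longrightarrow> p < ?W / z)"
  proof (intro exI[of _ "?D q"] conjI impI)
    have q': "0 \<le> q i \<and> q i \<le> \<alpha> i z / z" if "i \<in> {1..n}" for i using q[OF that] by blast
    show "((\<lambda>z. series_weight n (\<lambda>i. \<alpha> i z)) has_real_derivative ?D q) (at_left z)"
      by (rule deriv) (use q in blast)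
    show "0 \<le> ?D q" "?D q \<le> ?W / z" by (rule elast(1)[OF q'] elast(2)[OF q'], assumption)+
    show "0 < ?D q" if "Min (m ` {1..n}) < z"
      by (rule elast(3)[OF q']) (use m'[OF that] q in blast)+
    show "?D q < ?W / z" if "z < Max (k ` {1..n})"
      by (rule elast(4)[OF q']) (use k[OF that] q in blast)+
  qed
qed

section \<open>Superlevel sets and feasible values\<close>

text \<open>
  The last point with value at least \<open>z\<close>, obtained from the first one by reflecting the argument;
  this makes all facts about rising branches available for falling ones.
\<close>
definition last_reach :: "(real \<Rightarrow> real) \<Rightarrow> real \<Rightarrow> real \<Rightarrow> real \<Rightarrow> real" where
  "last_reach \<psi> b xu z = - first_reach (\<lambda>x. \<psi> (- x)) (- xu) (- b) z"

lemma rising_branch_of_S0: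
  assumes "continuous_on {xl..xu} \<psi>" "S0_transition xl xu \<psi> a b"
  shows "rising_branch \<psi> xl a" and "rising_branch (\<lambda>x. \<psi> (- x)) (- xu) (- b)"
proof -
  show "rising_branch \<psi> xl a"
    using assms by unfold_locales (auto simp: S0_transition_def intro: continuous_on_subset)
  have "continuous_on {- xu..- b} (\<lambda>x. \<psi> (- x))"
    by (rule continuous_on_compose2[OF assms(1)])
       (use assms(2) in \<open>auto simp: S0_transition_def intro!: continuous_intros\<close>)
  moreover have "strict_mono_on {- xu..- b} (\<lambda>x. \<psi> (- x))"
    using assms(2) by (auto simp: S0_transition_def monotone_on_def)
  ultimately show "rising_branch (\<lambda>x. \<psi> (- x)) (- xu) (- b)"
    using assms(2) by unfold_locales (auto simp: S0_transition_def)
qed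

lemma S0_transition_plateau:
  assumes "S0_transition xl xu \<psi> a b" "x \<in> {a..b}"
  shows "\<psi> x = \<psi> a"
  using assms by (auto simp: S0_transition_def constant_on_def)

lemma S0_transition_le_plateau:
  assumes "continuous_on {xl..xu} \<psi>" "S0_transition xl xu \<psi> a b" "x \<in> {xl..xu}"
  shows "\<psi> x \<le> \<psi> a"
proof -
  interpret up: rising_branch \<psi> xl a by (rule rising_branch_of_S0(1)[OF assms(1,2)])
  interpret down: rising_branch "\<lambda>x. \<psi> (- x)" "- xu" "- b"
    by (rule rising_branch_of_S0(2)[OF assms(1,2)])
  have ab: "a \<le> b" "\<psi> b = \<psi> a"
    using assms(2) S0_transition_plateau[OF assms(2), of b] by (auto simp: S0_transition_def)
  consider "x \<le> a" | "x \<in> {a..b}" | "b \<le> x" by force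
  then show ?thesis
    by cases (use assms(3) up.le_iff[of x a] up.xl_le_a down.xl_le_a down.le_iff[of "- x" "- b"] ab
      S0_transition_plateau[OF assms(2), of x] in auto)
qed

lemma superlevel_iff:
  assumes "continuous_on {xl..xu} \<psi>" "S0_transition xl xu \<psi> a b" and z: "z \<le> \<psi> a"
  shows "first_reach \<psi> xl a z \<in> {xl..a}" and "last_reach \<psi> b xu z \<in> {b..xu}"
    and "x \<in> {xl..xu} \<Longrightarrow> z \<le> \<psi> x \<longleftrightarrow> first_reach \<psi> xl a z \<le> x \<and> x \<le> last_reach \<psi> b xu z"
proof -
  interpret up: rising_branch \<psi> xl a by (rule rising_branch_of_S0(1)[OF assms(1,2)])
  interpret down: rising_branch "\<lambda>x. \<psi> (- x)" "- xu" "- b"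
    by (rule rising_branch_of_S0(2)[OF assms(1,2)])
  have ab: "a \<le> b" "\<psi> b = \<psi> a"
    using assms(2) S0_transition_plateau[OF assms(2), of b] by (auto simp: S0_transition_def)
  show F: "first_reach \<psi> xl a z \<in> {xl..a}" by (rule up.first_reach_mem[OF z])
  show L: "last_reach \<psi> b xu z \<in> {b..xu}"
    using down.first_reach_mem[of z] z ab unfolding last_reach_def by auto
  show "z \<le> \<psi> x \<longleftrightarrow> first_reach \<psi> xl a z \<le> x \<and> x \<le> last_reach \<psi> b xu z" if x: "x \<in> {xl..xu}"
  proof -
    consider "x \<le> a" | "x \<in> {a..b}" | "b \<le> x" by force
    then show ?thesis
    proof cases
      case 1
      then show ?thesis using up.first_reach_le_iff[OF z, of x] x F L ab by auto
    next
      case 2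
      then show ?thesis using S0_transition_plateau[OF assms(2) 2] z F L by auto
    next
      case 3
      then show ?thesis
        using down.first_reach_le_iff[of z "- x"] z x F L ab unfolding last_reach_def by auto
    qed
  qed
qed

text \<open>
  Monotonicity of the series weight gives the two bounds on \<open>W\<close>. Conversely, the segment from the
  smallest to the largest admissible weight vector stays in the box of admissible weights, and by the
  intermediate value theorem the series weight takes the value \<open>W\<close> on it.
\<close>
lemma feasible_values_eq:
  assumes n: "n \<ge> 1" and wl: "\<And>i. i \<in> {1..n} \<Longrightarrow> 0 < wl i"
    and cont: "\<And>i. i \<in> {1..n} \<Longrightarrow> continuous_on {wl i..wu i} (c i)"
    and tr: "\<And>i. i \<in> {1..n} \<Longrightarrow> S0_transition (wl i) (wu i) (c i) (a i) (b i)"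
  shows "feasible_values n wl wu c W =
    {z. z \<le> Min ((\<lambda>i. c i (a i)) ` {1..n}) \<and>
        series_weight n (\<lambda>i. first_reach (c i) (wl i) (a i) z) \<le> W \<and>
        W \<le> series_weight n (\<lambda>i. last_reach (c i) (b i) (wu i) z)}"
    (is "_ = {z. z \<le> ?M \<and> series_weight n (?\<alpha> z) \<le> W \<and> W \<le> series_weight n (?\<beta> z)}")
proof -
  have M: "z \<le> ?M \<longleftrightarrow> (\<forall>i\<in>{1..n}. z \<le> c i (a i))" for z
    using n by (subst Min_ge_iff) auto
  have ab: "wl i \<le> a i" "a i \<le> b i" "b i \<le> wu i" if "i \<in> {1..n}" for i
    using tr[OF that] by (auto simp: S0_transition_def)
  note super = superlevel_iff[OF cont tr]
  have F: "0 < ?\<alpha> z i" "wl i \<le> ?\<alpha> z i" "?\<alpha> z i \<le> ?\<beta> z i" "?\<beta> z i \<le> wu i"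
    if "i \<in> {1..n}" "z \<le> ?M" for i z
    using super(1,2)[of i z] that wl[of i] ab[of i] unfolding M by force+
  show ?thesis
  proof (intro set_eqI iffI)
    fix z assume "z \<in> feasible_values n wl wu c W"
    then obtain w where w: "\<And>i. i \<in> {1..n} \<Longrightarrow> 0 < w i \<and> wl i \<le> w i \<and> w i \<le> wu i \<and> z \<le> c i (w i)"
      and W: "series_weight n w = W"
      unfolding feasible_values_def by blast
    have zM: "z \<le> ?M"
      unfolding M using S0_transition_le_plateau[OF cont tr] w by (meson atLeastAtMost_iff order_trans)
    have "?\<alpha> z i \<le> w i \<and> w i \<le> ?\<beta> z i" if "i \<in> {1..n}" for i
      using super(3)[of i z "w i"] that w[OF that] zM unfolding M by auto
    then have "series_weight n (?\<alpha> z) \<le> series_weight n w" "series_weight n w \<le> series_weight n (?\<beta> z)"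
      using F zM w by (auto intro!: series_weight_mono)
    then show "z \<in> {z. z \<le> ?M \<and> series_weight n (?\<alpha> z) \<le> W \<and> W \<le> series_weight n (?\<beta> z)}"
      using zM W by simp
  next
    fix z assume z: "z \<in> {z. z \<le> ?M \<and> series_weight n (?\<alpha> z) \<le> W \<and> W \<le> series_weight n (?\<beta> z)}"
    then have zM: "z \<le> ?M" by simp
    define w where "w t i = ?\<alpha> z i + t * (?\<beta> z i - ?\<alpha> z i)" for t i
    have wi: "?\<alpha> z i \<le> w t i" "w t i \<le> ?\<beta> z i" if "i \<in> {1..n}" "t \<in> {0..1}" for i t
      using F(3)[OF that(1) zM] that(2) mult_left_le_one_le[of "?\<beta> z i - ?\<alpha> z i" t]
      by (auto simp: w_def)
    have wpos: "0 < w t i" if "i \<in> {1..n}" "t \<in> {0..1}" for i t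
      using wi(1)[OF that] F(1)[OF that(1) zM] by simp
    have "continuous_on {0..1} (\<lambda>t. series_weight n (\<lambda>i. w t i))"
      by (rule continuous_on_series_weight[OF n])
         (use wpos in \<open>auto simp: w_def[abs_def] intro!: continuous_intros\<close>)
    moreover have "series_weight n (w 0) \<le> W" "W \<le> series_weight n (w 1)"
      using z by (auto simp: w_def[abs_def])
    ultimately obtain t where t: "t \<in> {0..1}" "series_weight n (w t) = W"
      using IVT'[of "\<lambda>t. series_weight n (w t)" 0 W 1] by auto
    have "wl i \<le> w t i \<and> w t i \<le> wu i \<and> z \<le> c i (w t i)" if i: "i \<in> {1..n}" for i
      using super(3)[of i z "w t i"] i zM wi[OF i t(1)] F[OF i zM] unfolding M by auto
    then show "z \<in> feasible_values n wl wu c W"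
      unfolding feasible_values_def using t wpos by blast
  qed
qed

section \<open>The function inverse to two opposite branches\<close>

text \<open>
  For \<open>W\<close> left of \<open>A M\<close> only the constraint \<open>A z \<le> W\<close> binds, since \<open>A M \<le> B M \<le> B z\<close>; right of
  \<open>B M\<close> only \<open>W \<le> B z\<close> does.
\<close>
lemma greatest_between_branches:
  fixes A B :: "real \<Rightarrow> real"
  assumes up: "rising_branch A m M" and down: "rising_branch (\<lambda>z. - B z) m' M"
    and monoA: "mono_on {..M} A" and antimonoB: "antimono_on {..M} B" and AB: "A M \<le> B M"
  defines "F \<equiv> \<lambda>W. {z. z \<le> M \<and> A z \<le> W \<and> W \<le> B z}"
  defines "P \<equiv> \<lambda>W g. g \<in> F W \<and> (\<forall>y\<in>F W. y \<le> g)"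
  shows "W \<in> {A m..A M} \<Longrightarrow> P W (first_reach A m M W)"
    and "W \<in> {A M..B M} \<Longrightarrow> P W M"
    and "W \<in> {B M..B m'} \<Longrightarrow> P W (first_reach (\<lambda>z. - B z) m' M (- W))"
proof -
  interpret up: rising_branch A m M by (rule up)
  interpret down: rising_branch "\<lambda>z. - B z" m' M by (rule down)
  show "P W M" if "W \<in> {A M..B M}"
    using that by (auto simp: P_def F_def)
  show "P W (first_reach A m M W)" if W: "W \<in> {A m..A M}"
  proof -
    let ?z = "first_reach A m M W"
    have z: "?z \<in> {m..M}" "A ?z = W"
      using up.first_reach_mem[of W] up.value_first_reach[of W] W by auto
    have "W \<le> B ?z" using monotone_onD[OF antimonoB, of ?z M] z AB W by auto
    moreover have "y \<le> ?z" if "y \<in> F W" for y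
      using up.le_iff[of y ?z] z that by (cases "y \<ge> m") (auto simp: F_def)
    ultimately show ?thesis using z by (auto simp: P_def F_def)
  qed
  show "P W (first_reach (\<lambda>z. - B z) m' M (- W))" if W: "W \<in> {B M..B m'}"
  proof -
    let ?z = "first_reach (\<lambda>z. - B z) m' M (- W)"
    have z: "?z \<in> {m'..M}" "B ?z = W"
      using down.first_reach_mem[of "- W"] down.value_first_reach[of "- W"] W by auto
    have "A ?z \<le> W" using mono_onD[OF monoA, of ?z M] z AB W by auto
    moreover have "y \<le> ?z" if "y \<in> F W" for y
      using down.le_iff[of y ?z] z that by (cases "y \<ge> m'") (auto simp: F_def)
    ultimately show ?thesis using z by (auto simp: P_def F_def)
  qed
qed

lemma S0_of_inverse_branches:
  fixes A B C :: "real \<Rightarrow> real"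
  assumes up: "rising_branch A m M" and down: "rising_branch (\<lambda>z. - B z) m' M"
    and AB: "A M \<le> B M"
    and C: "\<And>W. W \<in> {A m..A M} \<Longrightarrow> C W = first_reach A m M W"
      "\<And>W. W \<in> {A M..B M} \<Longrightarrow> C W = M"
      "\<And>W. W \<in> {B M..B m'} \<Longrightarrow> C W = first_reach (\<lambda>z. - B z) m' M (- W)"
  shows "continuous_on {A m..B m'} C" and "S0_transition (A m) (B m') C (A M) (B M)"
proof -
  interpret up: rising_branch A m M by (rule up)
  interpret down: rising_branch "\<lambda>z. - B z" m' M by (rule down)
  have le: "A m \<le> A M" "B M \<le> B m'"
    using up.le_iff[of m M] down.le_iff[of m' M] up.xl_le_a down.xl_le_a by auto
  have "continuous_on {A m..A M} C"
    using continuous_on_subset[OF up.continuous_first_reach, of "{A m..A M}"]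
    by (subst continuous_on_cong[OF refl C(1)]) auto
  moreover have "continuous_on {A M..B M} C"
    by (subst continuous_on_cong[OF refl C(2)]) auto
  moreover have "continuous_on {B M..B m'} C"
  proof -
    have "continuous_on {B M..B m'} (\<lambda>W. first_reach (\<lambda>z. - B z) m' M (- W))"
      by (rule continuous_on_compose2[OF down.continuous_first_reach])
         (auto intro!: continuous_intros)
    then show ?thesis by (subst continuous_on_cong[OF refl C(3)]) auto
  qed
  ultimately have "continuous_on (({A m..A M} \<union> {A M..B M}) \<union> {B M..B m'}) C"
    by (intro continuous_on_closed_Un) auto
  moreover have "({A m..A M} \<union> {A M..B M}) \<union> {B M..B m'} = {A m..B m'}"
    using le AB by auto
  ultimately show "continuous_on {A m..B m'} C" by simp
  show "S0_transition (A m) (B m') C (A M) (B M)"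
    unfolding S0_transition_def
  proof (intro conjI)
    show "strict_mono_on {A m..A M} C"
      by (rule strict_mono_onI) (auto simp: C(1) intro: up.first_reach_less)
    show "C constant_on {A M..B M}"
      unfolding constant_on_def using C(2) by blast
    show "strict_antimono_on {B M..B m'} C"
      by (auto simp: monotone_on_def C(3) intro: down.first_reach_less)
  qed (use le AB in auto)
qed

text \<open>
  On its rising part \<open>C\<close> is the clamped inverse of \<open>A\<close>, so the differentiation rule that led from
  \<open>\<psi>\<close> to its inverse also leads back from \<open>A\<close> to \<open>C\<close>. For \<open>k \<le> z\<close> the right derivative of \<open>C\<close>
  equals \<open>z / A z\<close>; it is the minimum, because the left one is at least as large.
\<close>
lemma is_min_deriv_inverse:
  assumes up: "rising_branch A m M" and prof: "inverse_profile m k M A"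
    and C: "\<And>W. W \<in> {A m..A M} \<Longrightarrow> C W = first_reach A m M W"
    and m: "0 < m" "0 < A m" and z: "m \<le> z" "z < M"
  shows "\<exists>d. is_min_deriv (A m) C (A z) d \<and>
    (z < k \<longrightarrow> C (A z) / A z < d) \<and> (k \<le> z \<longrightarrow> d = C (A z) / A z)"
proof -
  interpret rising_branch A m M by (rule up)
  note mono = strict_mono_onD[OF strict_mono]
  have z0: "0 < z" "0 < A z" and Az: "A m \<le> A z" "A z < A M" and fz: "first_reach A m M (A z) = z"
    using m z le_iff[of m z] mono[of z M] first_reach_value[of z] by auto
  have CA: "C (A z) = z" using C[of "A z"] Az fz by simp
  have transfer: "(C has_real_derivative d) (at (A z) within T)"
    if d: "(first_reach A m M has_real_derivative d) (at (A z) within T)"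
      and ev: "\<forall>\<^sub>F W in at (A z) within T. W \<in> {A m..A M}" for d T
  proof -
    have "\<forall>\<^sub>F W in at (A z) within T. (first_reach A m M W - first_reach A m M (A z)) / (W - A z) =
        (C W - C (A z)) / (W - A z)"
      using ev by eventually_elim (simp add: C CA fz)
    with d show ?thesis
      unfolding has_field_derivative_iff by (rule Lim_transform_eventually)
  qed
  have evM: "\<forall>\<^sub>F W in at (A z) within T. W < A M" for T
    using Az(2) by (intro order_tendstoD(2)[OF tendsto_ident_at])
  obtain p where p: "(A has_real_derivative p) (at_right z)" "0 < p" "p \<le> A z / z"
    "z < k \<Longrightarrow> p < A z / z" "k \<le> z \<Longrightarrow> p = A z / z"
    using prof z z0 unfolding inverse_profile_def by blast
  have pR: "(C has_real_derivative inverse p) (at_right (A z))"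
  proof (rule transfer)
    show "(first_reach A m M has_real_derivative inverse p) (at_right (A z))"
      by (rule first_reach_derivative[where S = "{z<..}"])
         (use p Az z fz first_reach_less[of "A z"] in auto)
    show "\<forall>\<^sub>F W in at_right (A z). W \<in> {A m..A M}"
      using evM[of "{A z<..}"] eventually_at_right_less[of "A z"]
      by eventually_elim (use Az in auto)
  qed
  have inv_ge: "z / A z \<le> inverse p" if "p \<le> A z / z" "0 < p" for p
    using le_imp_inverse_le[OF that] by simp
  have inv_gt: "z / A z < inverse p" if "p < A z / z" "0 < p" for p
    using less_imp_inverse_less[OF that] by simp
  show ?thesis
  proof (cases "z = m")
    case True
    then have "is_min_deriv (A m) C (A z) (inverse p)" using pR by (simp add: is_min_deriv_def)
    then show ?thesis using p inv_gt CA by (intro exI[of _ "inverse p"]) auto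
  next
    case False
    then have mz: "m < z" using z by simp
    have Amz: "A m < A z" using mono[of m z] mz z by auto
    obtain q where q: "(A has_real_derivative q) (at_left z)" "0 < q" "q \<le> A z / z"
      "z < k \<Longrightarrow> q < A z / z"
      using prof mz z z0 unfolding inverse_profile_def by blast
    have "(C has_real_derivative inverse q) (at_left (A z))"
    proof (rule transfer)
      show "(first_reach A m M has_real_derivative inverse q) (at_left (A z))"
        by (rule first_reach_derivative[where S = "{..<z}"])
           (use q Az Amz z fz first_reach_less[of _ "A z"] in auto)
      have "\<forall>\<^sub>F W in at_left (A z). A m < W"
        using Amz by (intro order_tendstoD(1)[OF tendsto_ident_at])
      then show "\<forall>\<^sub>F W in at_left (A z). W \<in> {A m..A M}"
        using evM[of "{..<A z}"] by eventually_elim auto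
    qed
    then have "is_min_deriv (A m) C (A z) (min (inverse q) (inverse p))"
      using pR Amz by (auto simp: is_min_deriv_def)
    moreover have "min (inverse q) (inverse p) = z / A z" if "k \<le> z"
      using p(5)[OF that] inv_ge[of q] q by (simp add: min_def)
    ultimately show ?thesis
      using p q inv_gt CA by (intro exI[of _ "min (inverse q) (inverse p)"]) auto
  qed
qed

section \<open>The equivalent capacity of a series network\<close>
theorem lemma10:
  fixes n :: nat and wl wu :: "nat \<Rightarrow> real" and c :: "nat \<Rightarrow> real \<Rightarrow> real"
  assumes "n \<ge> 1"
    and "\<And>i. i \<in> {1..n} \<Longrightarrow> 0 < wl i"
    and "\<And>i. i \<in> {1..n} \<Longrightarrow> 0 < wu i"
    and "\<And>i. i \<in> {1..n} \<Longrightarrow> wl i \<le> wu i"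
    and "\<And>i x. i \<in> {1..n} \<Longrightarrow> x \<in> {wl i..wu i} \<Longrightarrow> 0 < c i x"
    and "\<And>i. i \<in> {1..n} \<Longrightarrow> S1 (wl i) (wu i) (c i)"
  shows "(\<forall>weq\<in>{series_weight n wl..series_weight n wu}.
            \<exists>z\<in>feasible_values n wl wu c weq. \<forall>y\<in>feasible_values n wl wu c weq. y \<le> z) \<and>
         S1 (series_weight n wl) (series_weight n wu) (equiv_capacity n wl wu c)"
proof -
  let ?I = "{1..n}"
  have I: "finite ?I" "?I \<noteq> {}" using assms(1) by auto
  \<comment> \<open>Naming the condition allows one simultaneous choice of transition points for all links.\<close>
  define Q where "Q i a b xo \<longleftrightarrow> S0_transition (wl i) (wu i) (c i) a b \<and> xo \<in> {wl i..a} \<and>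
        (\<forall>x\<in>{wl i..<xo}. \<exists>d. is_min_deriv (wl i) (c i) x d \<and> d > c i x / x) \<and>
        (\<forall>x\<in>{xo..<a}. \<exists>d. is_min_deriv (wl i) (c i) x d \<and> d = c i x / x)" for i a b xo
  have "\<exists>a b xo. Q i a b xo" if "i \<in> ?I" for i
    using assms(6)[OF that] unfolding S1_def Q_def by blast
  then obtain a b xo where Q: "\<And>i. i \<in> ?I \<Longrightarrow> Q i (a i) (b i) (xo i)"
    by metis
  have tr: "\<And>i. i \<in> ?I \<Longrightarrow> S0_transition (wl i) (wu i) (c i) (a i) (b i)"
    and xo: "\<And>i. i \<in> ?I \<Longrightarrow> xo i \<in> {wl i..a i}"
    and gt: "\<And>i x. i \<in> ?I \<Longrightarrow> wl i \<le> x \<Longrightarrow> x < xo i \<Longrightarrow> \<exists>d. is_min_deriv (wl i) (c i) x d \<and> c i x / x < d"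
    and eq: "\<And>i x. i \<in> ?I \<Longrightarrow> xo i \<le> x \<Longrightarrow> x < a i \<Longrightarrow> is_min_deriv (wl i) (c i) x (c i x / x)"
    using Q unfolding Q_def by force+
  have cont: "\<And>i. i \<in> ?I \<Longrightarrow> continuous_on {wl i..wu i} (c i)"
    using assms(6) by (auto simp: S1_def S0_def)
  define \<alpha> where "\<alpha> i = first_reach (c i) (wl i) (a i)" for i
  define \<beta> where "\<beta> i = last_reach (c i) (b i) (wu i)" for i
  define A where "A z = series_weight n (\<lambda>i. \<alpha> i z)" for z
  define B where "B z = series_weight n (\<lambda>i. \<beta> i z)" for z
  define M where "M = Min ((\<lambda>i. c i (a i)) ` ?I)"
  define m where "m = Min ((\<lambda>i. c i (wl i)) ` ?I)"
  define m' where "m' = Min ((\<lambda>i. c i (wu i)) ` ?I)"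
  define k where "k = Max ((\<lambda>i. c i (xo i)) ` ?I)"
  let ?C = "equiv_capacity n wl wu c"
  note upb = rising_branch_of_S0(1)[OF cont tr] and downb = rising_branch_of_S0(2)[OF cont tr]
  have ab: "wl i \<le> a i" "a i \<le> b i" "b i \<le> wu i" "c i (b i) = c i (a i)" if "i \<in> ?I" for i
    using tr[OF that] S0_transition_plateau[OF tr[OF that], of "b i"] by (auto simp: S0_transition_def)
  have Mle: "M \<le> c i (a i)" if "i \<in> ?I" for i using that by (auto simp: M_def)
  have mle: "m \<le> c i (wl i)" "m' \<le> c i (wu i)" if "i \<in> ?I" for i using that by (auto simp: m_def m'_def)
  have attained: "\<exists>i\<in>?I. f i = Min (f ` ?I)" for f :: "nat \<Rightarrow> real"
  proof -
    have "Min (f ` ?I) \<in> f ` ?I" using I by (intro Min_in) auto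
    then show ?thesis by (metis imageE)
  qed
  obtain j where j: "j \<in> ?I" "c j (wl j) = m" using attained[of "\<lambda>i. c i (wl i)"] unfolding m_def by blast
  obtain j' where j': "j' \<in> ?I" "c j' (wu j') = m'" using attained[of "\<lambda>i. c i (wu i)"] unfolding m'_def by blast
  obtain l where l: "l \<in> ?I" "c l (a l) = M" using attained[of "\<lambda>i. c i (a i)"] unfolding M_def by blast
  have mM: "m \<le> M" "m' \<le> M"
    using mle[OF l(1)] assms(4)[OF l(1)] l(2)
      S0_transition_le_plateau[OF cont tr, OF l(1) l(1), of "wl l"]
      S0_transition_le_plateau[OF cont tr, OF l(1) l(1), of "wu l"] by auto
  have m0: "0 < m" using assms(5)[of j "wl j"] assms(4)[of j] j by auto
  have wlpos: "0 < series_weight n wl" using assms(1,2) by (intro series_weight_pos)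
  have \<alpha>: "\<alpha> i z \<in> {wl i..a i}" "\<beta> i z \<in> {b i..wu i}" "0 < \<alpha> i z" "0 < \<beta> i z"
    if "i \<in> ?I" "z \<le> M" for i z
    using superlevel_iff(1,2)[OF cont tr, OF that(1) that(1), of z] Mle[OF that(1)] that
      assms(2)[OF that(1)] ab[OF that(1)] by (auto simp: \<alpha>_def \<beta>_def)
  have cont_\<alpha>: "continuous_on {..M} (\<alpha> i)" "continuous_on {..M} (\<beta> i)" if "i \<in> ?I" for i
    using rising_branch.continuous_first_reach[OF upb, OF that that]
      rising_branch.continuous_first_reach[OF downb, OF that that] Mle[OF that] ab(4)[OF that]
    unfolding \<alpha>_def \<beta>_def last_reach_def
    by (auto intro!: continuous_intros intro: continuous_on_subset)
  have contA: "continuous_on {..M} A" and contB: "continuous_on {..M} B"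
    unfolding A_def B_def using cont_\<alpha> \<alpha> by (auto intro!: continuous_on_series_weight assms(1))
  have mono_\<alpha>: "\<alpha> i y \<le> \<alpha> i z" "\<beta> i z \<le> \<beta> i y" if "i \<in> ?I" "y \<le> z" "z \<le> M" for i y z
    using mono_onD[OF rising_branch.mono_first_reach[OF upb, OF that(1) that(1)], of y z]
      mono_onD[OF rising_branch.mono_first_reach[OF downb, OF that(1) that(1)], of y z]
      that Mle[OF that(1)] ab(4)[OF that(1)]
    unfolding \<alpha>_def \<beta>_def last_reach_def by auto
  have monoA: "mono_on {..M} A" and antiB: "antimono_on {..M} B"
    unfolding A_def B_def monotone_on_def using mono_\<alpha> \<alpha> by (auto intro!: series_weight_mono)
  have upA: "rising_branch A m M"
  proof
    show "strict_mono_on {m..M} A"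
    proof (rule strict_mono_onI)
      fix y z assume yz: "y \<in> {m..M}" "z \<in> {m..M}" "y < z"
      have "\<alpha> j y < \<alpha> j z"
        using rising_branch.first_reach_less[OF upb, OF j(1) j(1), of y z] yz j Mle[OF j(1)]
        by (auto simp: \<alpha>_def)
      then show "A y < A z"
        unfolding A_def using yz mono_\<alpha> \<alpha> j by (intro series_weight_strict_mono[where j = j]) auto
    qed
  qed (use mM contA in \<open>auto intro: continuous_on_subset\<close>)
  have downB: "rising_branch (\<lambda>z. - B z) m' M"
  proof
    show "strict_mono_on {m'..M} (\<lambda>z. - B z)"
    proof (rule strict_mono_onI)
      fix y z assume yz: "y \<in> {m'..M}" "z \<in> {m'..M}" "y < z"
      have "\<beta> j' z < \<beta> j' y"
        using rising_branch.first_reach_less[OF downb, OF j'(1) j'(1), of y z] yz j' Mle[OF j'(1)]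
          ab(4)[OF j'(1)] by (auto simp: \<beta>_def last_reach_def)
      then have "B z < B y"
        unfolding B_def using yz mono_\<alpha> \<alpha> j' by (intro series_weight_strict_mono[where j = j']) auto
      then show "- B y < - B z" by simp
    qed
  qed (use mM contB in \<open>auto intro: continuous_on_subset intro!: continuous_intros\<close>)
  have AB: "A M \<le> B M"
    unfolding A_def B_def using \<alpha>[of _ M] ab by (intro series_weight_mono) force+
  have Am: "A m = series_weight n wl" and Bm': "B m' = series_weight n wu"
  proof -
    have "\<alpha> i m = wl i" "\<beta> i m' = wu i" if "i \<in> ?I" for i
      using rising_branch.first_reach_below[OF upb, OF that that, of m]
        rising_branch.first_reach_below[OF downb, OF that that, of m'] mle[OF that]
      by (auto simp: \<alpha>_def \<beta>_def last_reach_def)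
    then show "A m = series_weight n wl" "B m' = series_weight n wu"
      by (simp_all add: A_def B_def series_weight_def)
  qed
  have F: "feasible_values n wl wu c W = {z. z \<le> M \<and> A z \<le> W \<and> W \<le> B z}" for W
    unfolding M_def A_def B_def \<alpha>_def \<beta>_def
    by (rule feasible_values_eq[OF assms(1,2) cont tr])
  note greatest = greatest_between_branches[OF upA downB monoA antiB AB, folded F]
  have C_eq: "?C W = g"
    if "g \<in> feasible_values n wl wu c W \<and> (\<forall>y\<in>feasible_values n wl wu c W. y \<le> g)" for W g
    unfolding equiv_capacity_def using that by (intro Greatest_equality) auto
  note C = C_eq[OF greatest(1)] C_eq[OF greatest(2)] C_eq[OF greatest(3)]
  have S0: "continuous_on {A m..B m'} ?C" "S0_transition (A m) (B m') ?C (A M) (B M)"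
    by (rule S0_of_inverse_branches[OF upA downB AB C]; assumption)+
  have prof: "inverse_profile m k M A"
    unfolding m_def k_def A_def
  proof (rule inverse_profile_series_weight[OF assms(1)])
    fix i assume i: "i \<in> ?I"
    show "inverse_profile (c i (wl i)) (c i (xo i)) (c i (a i)) (\<alpha> i)"
      unfolding \<alpha>_def
      by (rule inverse_profile_first_reach)
         (use assms(2)[OF i] upb[OF i i] xo[OF i] gt[OF i] eq[OF i]
          in auto)
  qed (use Mle \<alpha> in auto)
  interpret A: rising_branch A m M by (rule upA)
  note deriv = is_min_deriv_inverse[OF upA prof C(1) m0 wlpos[folded Am]]
  have mk: "m \<le> k"
  proof -
    have "m \<le> c j (xo j)"
      using rising_branch.le_iff[OF upb, OF j(1) j(1), of "wl j" "xo j"] j xo[OF j(1)] by auto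
    also have "\<dots> \<le> k" using j by (auto simp: k_def)
    finally show ?thesis .
  qed
  \<comment> \<open>The threshold \<open>k\<close> may exceed the largest feasible value \<open>M\<close>; then no equality range is left.\<close>
  define Xo where "Xo = A (min M k)"
  have reach: "\<exists>z. m \<le> z \<and> z \<le> M \<and> A z = x" if "A m \<le> x" "x \<le> A M" for x
    using A.image_eq that by (metis atLeastAtMost_iff image_iff)
  have "S1 (A m) (B m') ?C"
    unfolding S1_def S0_def
  proof (intro conjI exI)
    show "0 < A m" using wlpos Am by simp
    show "Xo \<in> {A m..A M}" using A.le_iff mM mk by (auto simp: Xo_def)
    show "\<forall>x\<in>{A m..<Xo}. \<exists>d. is_min_deriv (A m) ?C x d \<and> ?C x / x < d"
    proof
      fix x assume x: "x \<in> {A m..<Xo}"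
      then obtain z where z: "m \<le> z" "z \<le> M" "A z = x"
        using reach[of x] \<open>Xo \<in> {A m..A M}\<close> by auto
      then have "z < M \<and> z < k" using x A.le_iff[of "min M k" z] mM mk by (auto simp: Xo_def)
      then show "\<exists>d. is_min_deriv (A m) ?C x d \<and> ?C x / x < d" using deriv[of z] z by auto
    qed
    show "\<forall>x\<in>{Xo..<A M}. \<exists>d. is_min_deriv (A m) ?C x d \<and> d = ?C x / x"
    proof
      fix x assume x: "x \<in> {Xo..<A M}"
      then obtain z where z: "m \<le> z" "z \<le> M" "A z = x"
        using reach[of x] \<open>Xo \<in> {A m..A M}\<close> by auto
      then have "z < M" using x by (cases "z = M") auto
      moreover have "k \<le> z" using x z \<open>z < M\<close> A.le_iff[of "min M k" z] mM mk by (auto simp: Xo_def)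
      ultimately show "\<exists>d. is_min_deriv (A m) ?C x d \<and> d = ?C x / x" using deriv[of z] z by auto
    qed
  qed (rule S0)+
  moreover have "\<exists>z\<in>feasible_values n wl wu c W. \<forall>y\<in>feasible_values n wl wu c W. y \<le> z"
    if W: "W \<in> {A m..B m'}" for W
  proof -
    consider "W \<in> {A m..A M}" | "W \<in> {A M..B M}" | "W \<in> {B M..B m'}"
      using W by force
    then show ?thesis by cases (blast dest: greatest)+
  qed
  ultimately show ?thesis unfolding Am Bm' by blast
qed

end
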